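(* Let $A\in\mathbb{R}^{m\times n}$ and let $S=\begin{bmatrix} S_1 & S_2\\ S_2 & S_1\end{bmatrix}\in\mathbb{R}^{2m\times 2n}$ be the block-structure matrix associated with $A$, with $\mathcal{R}(S_2)\subseteq\mathcal{R}(S_1)$. Let $$S=\begin{bmatrix}\mathcal{L}_{11} & O\\ \mathcal{L}_{21} & \mathcal{L}_{22}\end{bmatrix}\begin{bmatrix}U_{11} & U_{12}\\ O & U_{22}\end{bmatrix}$$ be the CRRMCF decomposition of $S$ (blocks $\mathcal{L}_{ij}\in\mathbb{R}^{m\times n}$, $U_{ij}\in\mathbb{R}^{n\times n}$). Then the Moore–Penrose inverse of $S$ is $$S^{\dagger}=\begin{bmatrix}B^{\dagger}[(\mathcal{L}_{11}U_{11})^T-C(H+F^{\dagger}D^T)] & B^{\dagger}[(\mathcal{L}_{21}U_{11})^T-C(K+F^{\dagger}E^T)]\\ H+F^{\dagger}D^T & K+F^{\dagger}E^T\end{bmatrix},$$ where $$\begin{aligned} B&=(\mathcal{L}_{11}U_{11})^T\mathcal{L}_{11}U_{11}+(\mathcal{L}_{21}U_{11})^T\mathcal{L}_{21}U_{11},\\ C&=(\mathcal{L}_{11}U_{11})^T\mathcal{L}_{11}U_{12}+(\mathcal{L}_{21}U_{11})^T(\mathcal{L}_{21}U_{12}+\mathcal{L}_{22}U_{22}),\\ D&=\mathcal{L}_{11}U_{12}-\mathcal{L}_{11}U_{11}B^{\dagger}C,\\ E&=(\mathcal{L}_{21}U_{12}+\mathcal{L}_{22}U_{22})-\mathcal{L}_{21}U_{11}B^{\dagger}C,\\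 F&=D^TD+E^TE,\\ G&=B^{\dagger}C(I-F^{\dagger}F),\\ H&=(I-F^{\dagger}F)(I+G^TG)^{-1}(B^{\dagger}C)^TB^{\dagger}\big((\mathcal{L}_{11}U_{11})^T-CF^{\dagger}D^T\big),\\ K&=(I-F^{\dagger}F)(I+G^TG)^{-1}(B^{\dagger}C)^TB^{\dagger}\big((\mathcal{L}_{21}U_{11})^T-CF^{\dagger}E^T\big). \end{aligned}$$
   Context: For $A=(d_{ij})\in\mathbb{R}^{m\times n}$, $S_1,S_2\in\mathbb{R}^{m\times n}$ are the matrices with entries $(S_1)_{ij}=d_{ij}$ if $d_{ij}\ge 0$ and $0$ otherwise, and $(S_2)_{ij}=-d_{ij}$ if $d_{ij}<0$ and $0$ otherwise; so $A=S_1-S_2$, and the block-structure matrix associated with $A$ is $S=\begin{bmatrix} S_1 & S_2\\ S_2 & S_1\end{bmatrix}$. $\mathcal{R}(M)$ is the range (column space) of $M$, $M^{\dagger}$ the Moore–Penrose inverse, $O$ a zero block. CRRMCF (Column Rank Revealing Minimal Canonical Form): let $G$ be a real $p\times q$ matrix of rank $t$, and let $\{(r_k,c_k)\}_{k=1}^{t}$, $c_1<\dots<c_t$, be the positions of the topmost nonzero entries (pivots) of the columns of $G$. $G$ is in CRRMCF if all entries to the right of the pivot entries are zero. Explicitly: $G(r_k,c_k)\neq 0$; $G(i,j)=0$ for all $i$ if $j\notin\{c_1,\dots,c_t\}$; $G(i,c_k)=0$ if $i<r_k$; $G(r_k,j)=0$ if $j>c_k$. A CRRMCF decomposition of a $p\times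 q$ matrix $M$ is $M=\mathcal{L}U$ with $\mathcal{L}\in\mathbb{R}^{p\times q}$ in CRRMCF and $U\in\mathbb{R}^{q\times q}$ unit upper triangular. The CRRMCF decomposition of $S$ used by the paper has blocks as follows: $S_1=\mathcal{L}_{11}U_{11}$ and $S_1-S_2U_{11}^{-1}\mathcal{L}_{11}^{\dagger}S_2=\mathcal{L}_{22}U_{22}$ are CRRMCF decompositions, $\mathcal{L}_{21}=S_2U_{11}^{-1}$, $U_{12}=\mathcal{L}_{11}^{\dagger}S_2$. *)

theory Defs
  imports
    "Jordan_Normal_Form.Gauss_Jordan_Elimination"
    "Jordan_Normal_Form.VS_Connect"
    "Jordan_Normal_Form.DL_Rank"
begin

text \<open>A matrix with \<open>p\<close> rows and \<open>q\<close> columns is an element of \<open>carrier_mat p q\<close>;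
  all row and column indices start at \<open>0\<close>.\<close>

definition pos_part_mat :: "real mat \<Rightarrow> real mat" where
  "pos_part_mat A = map_mat (\<lambda>d. if d \<ge> 0 then d else 0) A"

definition neg_part_mat :: "real mat \<Rightarrow> real mat" where
  "neg_part_mat A = map_mat (\<lambda>d. if d < 0 then - d else 0) A"

definition block_structure_mat :: "real mat \<Rightarrow> real mat" where
  "block_structure_mat A =
     four_block_mat (pos_part_mat A) (neg_part_mat A) (neg_part_mat A) (pos_part_mat A)"

definition mat_range :: "real mat \<Rightarrow> real vec set" where
  "mat_range M = vec_space.col_space (dim_row M) M"

definition is_mp_inverse :: "real mat \<Rightarrow> real mat \<Rightarrow> bool" where
  "is_mp_inverse M X \<longleftrightarrow>
     X \<in> carrier_mat (dim_col M) (dim_row M) \<and>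
     M * X * M = M \<and> X * M * X = X \<and>
     transpose_mat (M * X) = M * X \<and> transpose_mat (X * M) = X * M"

definition mp_inverse :: "real mat \<Rightarrow> real mat" where
  "mp_inverse M = (THE X. is_mp_inverse M X)"

text \<open>\<open>mat_inverse\<close> is \<open>option\<close>-valued; \<open>mat_inv M\<close> is meaningful for nonsingular \<open>M\<close> only.\<close>

definition mat_inv :: "real mat \<Rightarrow> real mat" where
  "mat_inv M = the (mat_inverse M)"

text \<open>Column rank revealing minimal canonical form. The pivot of the \<open>k\<close>-th nonzero column,
  \<open>k < t\<close>, is at position \<open>(r k, c k)\<close>.\<close>

definition crrmcf :: "real mat \<Rightarrow> bool" where
  "crrmcf G \<longleftrightarrow>
     (\<exists>(t::nat) (r::nat \<Rightarrow> nat) (c::nat \<Rightarrow> nat).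
        t = vec_space.rank (dim_row G) G \<and>
        strict_mono_on {..<t} c \<and>
        (\<forall>k<t. r k < dim_row G \<and> c k < dim_col G \<and> G $$ (r k, c k) \<noteq> 0) \<and>
        (\<forall>j<dim_col G. j \<notin> c ` {..<t} \<longrightarrow> (\<forall>i<dim_row G. G $$ (i, j) = 0)) \<and>
        (\<forall>k<t. \<forall>i<r k. G $$ (i, c k) = 0) \<and>
        (\<forall>k<t. \<forall>j<dim_col G. c k < j \<longrightarrow> G $$ (r k, j) = 0))"

definition unit_upper_triangular :: "real mat \<Rightarrow> bool" where
  "unit_upper_triangular U \<longleftrightarrow>
     square_mat U \<and> upper_triangular U \<and> (\<forall>i<dim_row U. U $$ (i, i) = 1)"

definition crrmcf_decomposition :: "real mat \<Rightarrow> real mat \<Rightarrow> real mat \<Rightarrow> bool" where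
  "crrmcf_decomposition M L U \<longleftrightarrow>
     L \<in> carrier_mat (dim_row M) (dim_col M) \<and>
     U \<in> carrier_mat (dim_col M) (dim_col M) \<and>
     crrmcf L \<and> unit_upper_triangular U \<and> M = L * U"

text \<open>The blockwise CRRMCF decomposition of
  \<open>S = four_block_mat S1 S2 S2 S1\<close>. The matrix decomposed in the second conjunct is the
  generalized Schur complement of \<open>S1\<close> in \<open>S\<close>. The factor
  \<open>four_block_mat L11 0 L21 L22\<close> is not required to be in CRRMCF itself, and need not be:
  for \<open>S1 = [1 0]\<close> and \<open>S2 = [0 1]\<close> it has rows \<open>[1 0 0 0]\<close> and \<open>[0 1 1 0]\<close>.\<close>

definition block_crrmcf_decomposition ::
  "real mat \<Rightarrow> real mat \<Rightarrow> real mat \<Rightarrow> real mat \<Rightarrow> real mat \<Rightarrow>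
   real mat \<Rightarrow> real mat \<Rightarrow> real mat \<Rightarrow> bool" where
  "block_crrmcf_decomposition S1 S2 L11 L21 L22 U11 U12 U22 \<longleftrightarrow>
     crrmcf_decomposition S1 L11 U11 \<and>
     crrmcf_decomposition (S1 - S2 * mat_inv U11 * mp_inverse L11 * S2) L22 U22 \<and>
     L21 = S2 * mat_inv U11 \<and>
     U12 = mp_inverse L11 * S2"

end

theory Submission
  imports Defs
begin

text \<open>Multiplying out the factorization gives \<open>S = [P Q]\<close> with block columns \<open>P = [L11 U11; L21 U11]\<close> and
  \<open>Q = [L11 U12; L21 U12 + L22 U22]\<close>. The claim is then Cline's formula for the Moore--Penrose inverse of
  a matrix split into two block columns.

  Let \<open>p\<close> be the inverse of \<open>P\<close>, \<open>T = p Q\<close>, \<open>R = Q - P T\<close> and let \<open>r\<close> be the inverse of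
  \<open>R\<close>. The columns of \<open>R\<close> are the components of the columns of \<open>Q\<close> orthogonal to the range
  of \<open>P\<close>, so the projector onto the range of \<open>S\<close> is \<open>P p + R r\<close>. Every block
  column \<open>X = [p - T Y; Y]\<close> with \<open>R Y = R r\<close> satisfies \<open>S X = P p + R r\<close>; the candidates
  differ in the part of \<open>Y\<close> lying in the kernel of \<open>R\<close>. With \<open>N = 1 - r R\<close> the projector
  onto this kernel and \<open>G = T N\<close>, symmetry of \<open>X S\<close> together with \<open>X S X = X\<close> selects
  \<open>Y = N (1 + G\<^sup>T G)\<^sup>-\<^sup>1 T\<^sup>T (p - T r) + r\<close>. This is lemma
  \<open>is_mp_inverse_append_cols\<close>.

  The theorem expresses these matrices through normal equations:
  \<open>B = P\<^sup>T P\<close>, \<open>C = P\<^sup>T Q\<close>, \<open>R = [D; E]\<close> and \<open>F = R\<^sup>T R\<close>. By lemma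
  \<open>is_mp_inverse_gram\<close>, the inverse of a matrix \<open>M\<close> is that of \<open>M\<^sup>T M\<close> times \<open>M\<^sup>T\<close>, so \<open>p\<close> and \<open>r\<close> are the
  expressions in \<open>B\<close> and \<open>F\<close> that the theorem displays, and \<open>[H K]\<close> is \<open>Y - r\<close>.

  Since \<open>mp_inverse\<close> is a definite description, existence and uniqueness of
  Moore--Penrose inverses are proved as well; existence is reduced to that of an inner inverse,
  which is read off from the reduced row echelon form.\<close>

section \<open>Matrix algebra with dimension side conditions\<close>

text \<open>The carrier premises of the library laws mention dimensions that do not occur in the equation.
  Stated with equations between dimensions, the laws are conditional rewrite rules whose side
  conditions the simplifier discharges.\<close>

lemma mult_assoc_dim:
  fixes X Y Z :: "real mat"
  assumes "dim_col X = dim_row Y" "dim_col Y = dim_row Z"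
  shows "X * Y * Z = X * (Y * Z)"
  using assms by (intro assoc_mult_mat) auto

lemma mult_distrib_dim:
  fixes X Y Z :: "real mat"
  shows "dim_row Y = dim_row Z \<Longrightarrow> dim_col Y = dim_col Z \<Longrightarrow> dim_col X = dim_row Y \<Longrightarrow>
           X * (Y + Z) = X * Y + X * Z"
    and "dim_row Y = dim_row Z \<Longrightarrow> dim_col Y = dim_col Z \<Longrightarrow> dim_col X = dim_row Y \<Longrightarrow>
           X * (Y - Z) = X * Y - X * Z"
    and "dim_row X = dim_row Y \<Longrightarrow> dim_col X = dim_col Y \<Longrightarrow> dim_col X = dim_row Z \<Longrightarrow>
           (X + Y) * Z = X * Z + Y * Z"
    and "dim_row X = dim_row Y \<Longrightarrow> dim_col X = dim_col Y \<Longrightarrow> dim_col X = dim_row Z \<Longrightarrow>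
           (X - Y) * Z = X * Z - Y * Z"
  by (auto intro!: mult_add_distrib_mat mult_minus_distrib_mat
      add_mult_distrib_mat minus_mult_distrib_mat)

lemma transpose_dim:
  fixes X Y Z :: "real mat"
  shows "dim_col X = dim_row Y \<Longrightarrow> transpose_mat (X * Y) = transpose_mat Y * transpose_mat X"
    and "dim_row X = dim_row Y \<Longrightarrow> dim_col X = dim_col Y \<Longrightarrow>
           transpose_mat (X + Y) = transpose_mat X + transpose_mat Y"
    and "dim_row X = dim_row Y \<Longrightarrow> dim_col X = dim_col Y \<Longrightarrow>
           transpose_mat (X - Y) = transpose_mat X - transpose_mat Y"
  by (auto intro!: transpose_mult transpose_add transpose_minus)

lemma unit_mult_dim:
  fixes X :: "real mat"
  shows "dim_row X = n \<Longrightarrow> 1\<^sub>m n * X = X" and "dim_col X = n \<Longrightarrow> X * 1\<^sub>m n = X"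
    and "dim_row X = n \<Longrightarrow> 0\<^sub>m k n * X = 0\<^sub>m k (dim_col X)"
    and "dim_col X = n \<Longrightarrow> X * 0\<^sub>m n k = 0\<^sub>m (dim_row X) k"
  by (auto intro: left_mult_one_mat right_mult_one_mat left_mult_zero_mat right_mult_zero_mat)

lemma add_zero_dim:
  fixes X :: "real mat"
  shows "dim_row X = n \<Longrightarrow> dim_col X = k \<Longrightarrow> X + 0\<^sub>m n k = X"
    and "dim_row X = n \<Longrightarrow> dim_col X = k \<Longrightarrow> 0\<^sub>m n k + X = X"
    and "dim_row X = n \<Longrightarrow> dim_col X = k \<Longrightarrow> X - 0\<^sub>m n k = X"
    and "dim_row X = n \<Longrightarrow> dim_col X = k \<Longrightarrow> X - X = 0\<^sub>m n k"
  by (auto intro!: eq_matI)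

lemmas mat_ring_simps = mult_assoc_dim mult_distrib_dim transpose_dim unit_mult_dim add_zero_dim

section \<open>Existence and uniqueness of Moore--Penrose inverses\<close>

text \<open>The diagonal of \<open>Z\<^sup>T Z\<close> consists of sums of squares of the entries of the columns of \<open>Z\<close>.\<close>

lemma gram_eq_zero:
  fixes Z :: "real mat"
  assumes "transpose_mat Z * Z = 0\<^sub>m (dim_col Z) (dim_col Z)"
  shows "Z = 0\<^sub>m (dim_row Z) (dim_col Z)"
proof (rule eq_matI)
  fix i j assume "i < dim_row (0\<^sub>m (dim_row Z) (dim_col Z))" "j < dim_col (0\<^sub>m (dim_row Z) (dim_col Z))"
  then have i: "i < dim_row Z" and j: "j < dim_col Z" by auto
  have "(transpose_mat Z * Z) $$ (j, j) = 0" using assms j by simp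
  then have "col Z j \<bullet> col Z j = 0" using j by simp
  then have "(\<Sum>k = 0..<dim_row Z. Z $$ (k, j) * Z $$ (k, j)) = 0"
    using j by (simp add: scalar_prod_def)
  then have "Z $$ (i, j) * Z $$ (i, j) = 0"
    using i by (subst (asm) sum_nonneg_eq_0_iff) auto
  then show "Z $$ (i, j) = 0\<^sub>m (dim_row Z) (dim_col Z) $$ (i, j)" using i j by simp
qed auto

text \<open>Over the reals \<open>M\<^sup>T M\<close> and \<open>M\<close> have the same kernel: with \<open>W = M X - M Y\<close>, the
  hypothesis gives \<open>W\<^sup>T W = 0\<close>.\<close>

lemma gram_cancel:
  fixes M X Y :: "real mat"
  assumes "X \<in> carrier_mat (dim_col M) k" "Y \<in> carrier_mat (dim_col M) k"
    and eq: "transpose_mat M * M * X = transpose_mat M * M * Y"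
  shows "M * X = M * Y"
proof -
  have d: "dim_row X = dim_col M" "dim_row Y = dim_col M" "dim_col X = k" "dim_col Y = k"
    using assms by auto
  have "transpose_mat (M * X - M * Y) * (M * X - M * Y)
      = transpose_mat (X - Y) * (transpose_mat M * M * X - transpose_mat M * M * Y)"
    using d by (simp add: mat_ring_simps)
  also have "\<dots> = 0\<^sub>m k k" unfolding eq using d by (simp add: mat_ring_simps)
  finally have "M * X - M * Y = 0\<^sub>m (dim_row M) k"
    using gram_eq_zero[of "M * X - M * Y"] d by simp
  then have "(M * X - M * Y) $$ (i, j) = 0" if "i < dim_row M" "j < k" for i j
    using that by simp
  then show ?thesis using d by (intro eq_matI) auto
qed

text \<open>If \<open>Z\<close> is an inner inverse of \<open>P M\<close> with \<open>P\<close> invertible, then \<open>Z P\<close> is one of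
  \<open>M\<close>, so it suffices to treat the reduced row echelon form. There the pivot columns are unit vectors, and the matrix
  that sends the unit vector of a pivot row to that of the pivot column of this row will do.\<close>

lemma exists_inner_inverse:
  fixes M :: "real mat"
  shows "\<exists>X \<in> carrier_mat (dim_col M) (dim_row M). M * X * M = M"
proof -
  define nr nc where "nr = dim_row M" and "nc = dim_col M"
  have M: "M \<in> carrier_mat nr nc" by (simp add: nr_def nc_def)
  define R where "R = gauss_jordan_single M"
  note gj = gauss_jordan_single[OF M R_def[symmetric]]
  have R: "R \<in> carrier_mat nr nc" by (rule gj(2))
  obtain P Q where PQ: "R = P * M" "P \<in> carrier_mat nr nr" "Q \<in> carrier_mat nr nr"
      "Q * P = 1\<^sub>m nr" using gj(4) by blast
  obtain f where f: "pivot_fun R f nc"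
    using gj(3) R unfolding row_echelon_form_def by auto
  note piv = pivot_funD[of R nr f nc, OF _ f]
  \<comment> \<open>A zero row \<open>i\<close> has \<open>f i = nc\<close>, which makes column \<open>i\<close> of \<open>Z\<close> zero.\<close>
  define Z where "Z = mat nc nr (\<lambda>(j, i). if j = f i then 1 else 0 :: real)"
  have Z: "Z \<in> carrier_mat nc nr" by (simp add: Z_def)
  have RZ: "R * Z = mat nr nr (\<lambda>(i, l). if i = l \<and> f i < nc then 1 else 0)"
  proof (rule eq_matI)
    fix i l assume "i < dim_row (mat nr nr (\<lambda>(i, l). if i = l \<and> f i < nc then 1 else 0))"
      "l < dim_col (mat nr nr (\<lambda>(i, l). if i = l \<and> f i < nc then 1 else 0))"
    then have il: "i < nr" "l < nr" by auto
    have "(R * Z) $$ (i, l) = (\<Sum>k = 0..<nc. R $$ (i, k) * Z $$ (k, l))"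
      using il R Z by (simp add: scalar_prod_def)
    also have "\<dots> = (\<Sum>k = 0..<nc. if k = f l then R $$ (i, f l) else 0)"
      using il by (intro sum.cong) (auto simp: Z_def)
    also have "\<dots> = (if f l < nc then R $$ (i, f l) else 0)" by simp
    also have "\<dots> = (if i = l \<and> f i < nc then 1 else 0)"
      using piv(4)[of l] piv(5)[of l i] il R by auto
    finally show "(R * Z) $$ (i, l)
        = mat nr nr (\<lambda>(i, l). if i = l \<and> f i < nc then 1 else 0) $$ (i, l)"
      using il by simp
  qed (use R Z in auto)
  have RZR: "R * Z * R = R"
  proof (rule eq_matI)
    fix i j assume "i < dim_row R" "j < dim_col R"
    then have ij: "i < nr" "j < nc" using R by auto
    have "(R * Z * R) $$ (i, j)
        = (\<Sum>k = 0..<nr. (if i = k \<and> f i < nc then 1 else 0) * R $$ (k, j))"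
      unfolding RZ using ij R by (simp add: scalar_prod_def)
    also have "\<dots> = (\<Sum>k = 0..<nr. if k = i then (if f i < nc then R $$ (i, j) else 0) else 0)"
      by (intro sum.cong) auto
    also have "\<dots> = (if f i < nc then R $$ (i, j) else 0)" using ij by simp
    also have "\<dots> = R $$ (i, j)" using piv(1)[of i] piv(2)[of i j] ij R by auto
    finally show "(R * Z * R) $$ (i, j) = R $$ (i, j)" .
  qed (use R Z in auto)
  have d: "dim_row M = nr" "dim_col M = nc" "dim_row P = nr" "dim_col P = nr" "dim_row Q = nr"
    "dim_col Q = nr" "dim_row Z = nc" "dim_col Z = nr" using M PQ Z by auto
  have "M * (Z * P) * M = Q * P * M * (Z * P) * M" using d PQ(4) by (simp add: mat_ring_simps)
  also have "\<dots> = Q * (R * Z * R)" using d unfolding PQ(1) by (simp add: mat_ring_simps)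
  also have "\<dots> = Q * P * M" unfolding RZR using d unfolding PQ(1) by (simp add: mat_ring_simps)
  also have "\<dots> = M" using d PQ(4) by (simp add: mat_ring_simps)
  finally show ?thesis using d by (intro bexI[of _ "Z * P"]) auto
qed

text \<open>Two inverses \<open>X\<close> and \<open>Y\<close> of \<open>M\<close> define the same projectors \<open>M X = M Y\<close> and
  \<open>X M = Y M\<close>, because symmetric idempotents with the same range are equal; then
  \<open>X = X M X = Y M Y = Y\<close>.\<close>

lemma is_mp_inverse_unique:
  assumes X: "is_mp_inverse M X" and Y: "is_mp_inverse M Y"
  shows "X = Y"
proof -
  note x = X[unfolded is_mp_inverse_def] and y = Y[unfolded is_mp_inverse_def]
  have d: "dim_row X = dim_col M" "dim_col X = dim_row M"
      "dim_row Y = dim_col M" "dim_col Y = dim_row M" using x y by auto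
  have "M * X = transpose_mat (M * Y * M * X)" using x y by simp
  also have "\<dots> = transpose_mat (M * X) * transpose_mat (M * Y)"
    using d by (simp add: mat_ring_simps)
  also have "\<dots> = (M * X) * (M * Y)" using x y by simp
  also have "\<dots> = M * X * M * Y" using d by (simp add: mat_ring_simps)
  also have "\<dots> = M * Y" using x by simp
  finally have l: "M * X = M * Y" .
  have "X * M = transpose_mat (X * (M * Y * M))" using x y by simp
  also have "\<dots> = transpose_mat (Y * M) * transpose_mat (X * M)"
    using d by (simp add: mat_ring_simps)
  also have "\<dots> = (Y * M) * (X * M)" using x y by simp
  also have "\<dots> = Y * (M * X * M)" using d by (simp add: mat_ring_simps)
  also have "\<dots> = Y * M" using x by simp
  finally have r: "X * M = Y * M" .
  have "X = X * M * X" using x by simp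
  also have "\<dots> = Y * M * X" by (simp add: r)
  also have "\<dots> = Y * M * Y" using l d by (simp add: mat_ring_simps)
  also have "\<dots> = Y" using y by simp
  finally show ?thesis .
qed

lemma mp_inverse_eqI: "is_mp_inverse M X \<Longrightarrow> mp_inverse M = X"
  unfolding mp_inverse_def using is_mp_inverse_unique by blast

text \<open>This says that \<open>M X M\<^sup>T\<close> fixes the columns of \<open>M\<close>. It follows by cancelling
  \<open>M\<^sup>T\<close> on the left of the hypothesis.\<close>

lemma inner_inverse_gram:
  fixes M X :: "real mat"
  assumes "X \<in> carrier_mat (dim_col M) (dim_col M)"
    and "transpose_mat M * M * X * (transpose_mat M * M) = transpose_mat M * M"
  shows "M * X * transpose_mat M * M = M"
proof -
  have d: "dim_row X = dim_col M" "dim_col X = dim_col M" using assms by auto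
  have "M * (X * (transpose_mat M * M)) = M * 1\<^sub>m (dim_col M)"
    by (rule gram_cancel[where k = "dim_col M"]) (use assms d in \<open>auto simp: mat_ring_simps\<close>)
  then show ?thesis using d by (simp add: mat_ring_simps)
qed


text \<open>Symmetry makes \<open>M X M\<^sup>T\<close> the orthogonal projector onto the range of \<open>M\<close>. If \<open>Y\<close>
  is any inner inverse of the symmetric matrix \<open>N = M\<^sup>T M\<close>, then \<open>Y N Y\<^sup>T\<close> is a symmetric one.\<close>

lemma exists_symmetric_inner_inverse_gram:
  fixes M :: "real mat"
  shows "\<exists>X \<in> carrier_mat (dim_col M) (dim_col M).
           transpose_mat X = X \<and> M * X * transpose_mat M * M = M"
proof -
  define N where "N = transpose_mat M * M"
  have dN: "dim_row N = dim_col M" "dim_col N = dim_col M" by (auto simp: N_def)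
  have sN: "transpose_mat N = N" unfolding N_def by (simp add: mat_ring_simps)
  obtain Y where Y: "Y \<in> carrier_mat (dim_col M) (dim_col M)" "N * Y * N = N"
    using exists_inner_inverse[of N] dN by auto
  have dY: "dim_row Y = dim_col M" "dim_col Y = dim_col M" using Y by auto
  define X where "X = Y * N * transpose_mat Y"
  have X: "X \<in> carrier_mat (dim_col M) (dim_col M)" using dY by (auto simp: X_def)
  have "transpose_mat X = X" unfolding X_def using sN dN dY by (simp add: mat_ring_simps)
  moreover have "N * X * N = N"
  proof -
    have "N * X * N = (N * Y * N) * transpose_mat Y * N"
      unfolding X_def using dN dY by (simp add: mat_ring_simps)
    also have "\<dots> = N * transpose_mat Y * N" unfolding Y(2) ..
    also have "\<dots> = transpose_mat (N * Y * N)" using dN dY sN by (simp add: mat_ring_simps)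
    finally show ?thesis using Y(2) sN by simp
  qed
  ultimately show ?thesis using inner_inverse_gram[of X M] X unfolding N_def by blast
qed

text \<open>Symmetric inner inverses \<open>Y\<close> of \<open>M\<^sup>T M\<close> and \<open>W\<close> of \<open>M M\<^sup>T\<close> yield the orthogonal
  projectors \<open>M Y M\<^sup>T\<close> and \<open>M\<^sup>T W M\<close> onto the column space and the row space
  of \<open>M\<close>. The matrix \<open>X = M\<^sup>T W M Y M\<^sup>T\<close> satisfies \<open>M X = M Y M\<^sup>T\<close> and
  \<open>X M = M\<^sup>T W M\<close>, from which all four Penrose equations follow.\<close>

lemma is_mp_inverse_mp_inverse: "is_mp_inverse M (mp_inverse M)"
proof -
  obtain Y where Y: "Y \<in> carrier_mat (dim_col M) (dim_col M)" "transpose_mat Y = Y"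
      "M * Y * transpose_mat M * M = M"
    using exists_symmetric_inner_inverse_gram[of M] by blast
  obtain W where W: "W \<in> carrier_mat (dim_row M) (dim_row M)" "transpose_mat W = W"
      "transpose_mat M * W * M * transpose_mat M = transpose_mat M"
    using exists_symmetric_inner_inverse_gram[of "transpose_mat M"] by auto
  have d: "dim_row Y = dim_col M" "dim_col Y = dim_col M"
    "dim_row W = dim_row M" "dim_col W = dim_row M" using Y W by auto
  have W': "M * transpose_mat M * W * M = M"
    using arg_cong[OF W(3), of transpose_mat] W(2) d by (simp add: mat_ring_simps)
  define X where "X = transpose_mat M * W * M * Y * transpose_mat M"
  have dX: "dim_row X = dim_col M" "dim_col X = dim_row M" by (auto simp: X_def)
  have "M * X = (M * transpose_mat M * W * M) * Y * transpose_mat M"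
    unfolding X_def using d by (simp add: mat_ring_simps)
  then have MX: "M * X = M * Y * transpose_mat M" unfolding W' .
  have "X * M = transpose_mat M * W * (M * Y * transpose_mat M * M)"
    unfolding X_def using d by (simp add: mat_ring_simps)
  then have XM: "X * M = transpose_mat M * W * M" unfolding Y(3) .
  have "X * M * X = (transpose_mat M * W * M * transpose_mat M) * (W * M * Y * transpose_mat M)"
    unfolding XM unfolding X_def using d by (simp add: mat_ring_simps)
  also have "\<dots> = X" unfolding W(3) unfolding X_def using d by (simp add: mat_ring_simps)
  finally have "X * M * X = X" .
  moreover have "M * X * M = M" unfolding MX using Y(3) .
  moreover have "transpose_mat (M * X) = M * X" unfolding MX using d Y(2) by (simp add: mat_ring_simps)
  moreover have "transpose_mat (X * M) = X * M" unfolding XM using d W(2) by (simp add: mat_ring_simps)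
  ultimately have "is_mp_inverse M X" using dX by (auto simp: is_mp_inverse_def)
  then show ?thesis using mp_inverse_eqI by metis
qed

lemma is_mp_inverse_transpose:
  assumes "is_mp_inverse M X"
  shows "is_mp_inverse (transpose_mat M) (transpose_mat X)"
proof -
  note x = assms[unfolded is_mp_inverse_def]
  have d: "dim_row X = dim_col M" "dim_col X = dim_row M" using x by auto
  have "transpose_mat M * transpose_mat X * transpose_mat M = transpose_mat (M * X * M)"
    "transpose_mat X * transpose_mat M * transpose_mat X = transpose_mat (X * M * X)"
    using d by (simp_all add: mat_ring_simps)
  moreover have "transpose_mat M * transpose_mat X = X * M"
    "transpose_mat X * transpose_mat M = M * X"
    using x d transpose_dim(1)[of X M] transpose_dim(1)[of M X] by auto
  ultimately show ?thesis using x d unfolding is_mp_inverse_def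
    by auto
qed

text \<open>The inverse of the symmetric matrix \<open>M\<^sup>T M\<close> is symmetric by uniqueness, so
  \<open>inner_inverse_gram\<close> applies to it.\<close>

lemma is_mp_inverse_gram:
  "is_mp_inverse M (mp_inverse (transpose_mat M * M) * transpose_mat M)"
proof -
  define N Y where "N = transpose_mat M * M" and "Y = mp_inverse N"
  have y: "is_mp_inverse N Y" unfolding Y_def by (rule is_mp_inverse_mp_inverse)
  have sN: "transpose_mat N = N" unfolding N_def by (simp add: mat_ring_simps)
  have sY: "transpose_mat Y = Y"
    by (rule is_mp_inverse_unique[OF is_mp_inverse_transpose[OF y, unfolded sN] y])
  note y = y[unfolded is_mp_inverse_def]
  have d: "dim_row Y = dim_col M" "dim_col Y = dim_col M" using y by (auto simp: N_def)
  have dN: "dim_row N = dim_col M" "dim_col N = dim_col M" by (auto simp: N_def)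
  have MYM: "M * Y * transpose_mat M * M = M"
    using inner_inverse_gram[of Y M] y d unfolding N_def by auto
  have XM: "Y * transpose_mat M * M = Y * N" unfolding N_def using d by (simp add: mat_ring_simps)
  have "Y * N * (Y * transpose_mat M) = (Y * N * Y) * transpose_mat M"
    using d dN by (simp add: mat_ring_simps)
  also have "\<dots> = Y * transpose_mat M" using y by simp
  finally have "Y * transpose_mat M * M * (Y * transpose_mat M) = Y * transpose_mat M"
    unfolding XM .
  moreover have "M * (Y * transpose_mat M) * M = M" using MYM d by (simp add: mat_ring_simps)
  moreover have "transpose_mat (M * (Y * transpose_mat M)) = M * (Y * transpose_mat M)"
    using d sY by (simp add: mat_ring_simps)
  moreover have "transpose_mat (Y * transpose_mat M * M) = Y * transpose_mat M * M"
    unfolding XM using y by simp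
  ultimately show ?thesis using d unfolding is_mp_inverse_def N_def Y_def by auto
qed

section \<open>Ordinary inverses\<close>

lemma mat_inv_properties:
  assumes "A \<in> carrier_mat n n" "det A \<noteq> 0"
  shows "mat_inv A \<in> carrier_mat n n" "A * mat_inv A = 1\<^sub>m n" "mat_inv A * A = 1\<^sub>m n"
proof -
  obtain X where "mat_inverse A = Some X"
    using mat_inverse(1)[OF assms(1), of "()"] det_non_zero_imp_unit[OF assms, of "()"] by fastforce
  then show "mat_inv A \<in> carrier_mat n n" "A * mat_inv A = 1\<^sub>m n" "mat_inv A * A = 1\<^sub>m n"
    using mat_inverse(2)[OF assms(1)] by (auto simp: mat_inv_def)
qed

text \<open>If \<open>(1 + G\<^sup>T G) v = 0\<close>, then \<open>v \<bullet> v + (G v) \<bullet> (G v) = 0\<close>, hence \<open>v = 0\<close>.\<close>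

lemma det_one_plus_gram:
  fixes G :: "real mat"
  assumes G: "G \<in> carrier_mat m n"
  shows "det (1\<^sub>m n + transpose_mat G * G) \<noteq> 0"
proof
  assume "det (1\<^sub>m n + transpose_mat G * G) = 0"
  then obtain v where v: "v \<in> carrier_vec n" "v \<noteq> 0\<^sub>v n"
    "(1\<^sub>m n + transpose_mat G * G) *\<^sub>v v = 0\<^sub>v n"
    using det_0_iff_vec_prod_zero[of "1\<^sub>m n + transpose_mat G * G" n] G by auto
  have "0 = v \<bullet> ((1\<^sub>m n + transpose_mat G * G) *\<^sub>v v)" using v by simp
  also have "(1\<^sub>m n + transpose_mat G * G) *\<^sub>v v = v + transpose_mat G *\<^sub>v (G *\<^sub>v v)"
    using v G by (subst add_mult_distrib_mat_vec[of _ n n]) auto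
  also have "v \<bullet> \<dots> = v \<bullet> v + v \<bullet> (transpose_mat G *\<^sub>v (G *\<^sub>v v))"
    using v G by (intro scalar_prod_add_distrib[of _ n]) auto
  also have "v \<bullet> (transpose_mat G *\<^sub>v (G *\<^sub>v v)) = (G *\<^sub>v v) \<bullet> (G *\<^sub>v v)"
    using v G transpose_vec_mult_scalar[of G m n v "G *\<^sub>v v"] 
      comm_scalar_prod[of v n "transpose_mat G *\<^sub>v (G *\<^sub>v v)"] by auto
  finally have "v \<bullet> v + (G *\<^sub>v v) \<bullet> (G *\<^sub>v v) = 0" by simp
  moreover have "0 \<le> v \<bullet> v" "0 \<le> (G *\<^sub>v v) \<bullet> (G *\<^sub>v v)"
    by (auto simp: scalar_prod_def intro!: sum_nonneg)
  ultimately have "v \<bullet> v = 0" by linarith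
  then show False using v conjugate_square_eq_0_vec[of v n] by simp
qed


section \<open>Block columns and block rows\<close>

text \<open>The counterpart of \<open>append_rows\<close>. The empty lower blocks let the product rule for
  \<open>2 \<times> 2\<close> block matrices compute \<open>[X1 X2] [Y1; Y2]\<close>.\<close>

definition append_cols :: "real mat \<Rightarrow> real mat \<Rightarrow> real mat" (infixr "@\<^sub>c" 65) where
  "X @\<^sub>c Y = four_block_mat X Y (0\<^sub>m 0 (dim_col X)) (0\<^sub>m 0 (dim_col Y))"

lemma append_dim [simp]:
  "dim_row (X @\<^sub>r Y) = dim_row X + dim_row Y" "dim_col (X @\<^sub>r Y) = dim_col X"
  "dim_row (X @\<^sub>c Y) = dim_row X" "dim_col (X @\<^sub>c Y) = dim_col X + dim_col Y"
  by (auto simp: append_rows_def append_cols_def)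

text \<open>Both readings are needed: \<open>S\<close> splits into block columns, its inverse into block rows.\<close>

lemma four_block_append:
  assumes "dim_row X2 = dim_row X1" "dim_row X4 = dim_row X3"
    "dim_col X3 = dim_col X1" "dim_col X4 = dim_col X2"
  shows "four_block_mat X1 X2 X3 X4 = (X1 @\<^sub>c X2) @\<^sub>r (X3 @\<^sub>c X4)"
    and "four_block_mat X1 X2 X3 X4 = (X1 @\<^sub>r X3) @\<^sub>c (X2 @\<^sub>r X4)"
  using assms by (auto simp: append_rows_def append_cols_def intro!: eq_matI)

lemma append_cols_mult_append_rows:
  assumes "dim_row X2 = dim_row X1" "dim_row Y1 = dim_col X1" "dim_row Y2 = dim_col X2"
    "dim_col Y2 = dim_col Y1"
  shows "(X1 @\<^sub>c X2) * (Y1 @\<^sub>r Y2) = X1 * Y1 + X2 * Y2"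
  unfolding append_rows_def append_cols_def
  by (subst mult_four_block_mat[where ?nr1.0 = "dim_row X1" and ?nr2.0 = 0
        and ?n1.0 = "dim_col X1" and ?n2.0 = "dim_col X2" and ?nc1.0 = "dim_col Y1" and ?nc2.0 = 0])
    (use assms in \<open>auto intro!: eq_matI\<close>)

lemma append_rows_mult:
  fixes X1 X2 Y :: "real mat"
  assumes "dim_col X2 = dim_col X1" "dim_row Y = dim_col X1"
  shows "(X1 @\<^sub>r X2) * Y = (X1 * Y) @\<^sub>r (X2 * Y)"
proof (rule eq_matI)
  fix i j assume "i < dim_row ((X1 * Y) @\<^sub>r (X2 * Y))" "j < dim_col ((X1 * Y) @\<^sub>r (X2 * Y))"
  then show "((X1 @\<^sub>r X2) * Y) $$ (i, j) = ((X1 * Y) @\<^sub>r (X2 * Y)) $$ (i, j)"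
    using assms by (auto simp: append_rows_def scalar_prod_def intro!: sum.cong)
qed auto

lemma mult_append_cols:
  assumes "dim_row Y1 = dim_col X" "dim_row Y2 = dim_col X"
  shows "X * (Y1 @\<^sub>c Y2) = (X * Y1) @\<^sub>c (X * Y2)"
proof (rule eq_matI)
  fix i j assume "i < dim_row ((X * Y1) @\<^sub>c (X * Y2))" "j < dim_col ((X * Y1) @\<^sub>c (X * Y2))"
  then show "(X * (Y1 @\<^sub>c Y2)) $$ (i, j) = ((X * Y1) @\<^sub>c (X * Y2)) $$ (i, j)"
    using assms by (auto simp: append_cols_def scalar_prod_def intro!: sum.cong)
qed auto

lemma append_rows_mult_append_cols:
  assumes "dim_col X2 = dim_col X1" "dim_row Y1 = dim_col X1" "dim_row Y2 = dim_col X1"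
  shows "(X1 @\<^sub>r X2) * (Y1 @\<^sub>c Y2) = four_block_mat (X1 * Y1) (X1 * Y2) (X2 * Y1) (X2 * Y2)"
  using assms by (simp add: append_rows_mult mult_append_cols four_block_append(2))

lemma append_minus:
  fixes X1 X2 Y1 Y2 :: "real mat"
  shows
  "dim_row X2 = dim_row X1 \<Longrightarrow> dim_row Y1 = dim_row X1 \<Longrightarrow> dim_row Y2 = dim_row X1 \<Longrightarrow>
    dim_col Y1 = dim_col X1 \<Longrightarrow> dim_col Y2 = dim_col X2 \<Longrightarrow>
    (X1 @\<^sub>c X2) - (Y1 @\<^sub>c Y2) = (X1 - Y1) @\<^sub>c (X2 - Y2)"
  and "dim_col X2 = dim_col X1 \<Longrightarrow> dim_col Y1 = dim_col X1 \<Longrightarrow> dim_col Y2 = dim_col X1 \<Longrightarrow>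
    dim_row Y1 = dim_row X1 \<Longrightarrow> dim_row Y2 = dim_row X2 \<Longrightarrow>
    (X1 @\<^sub>r X2) - (Y1 @\<^sub>r Y2) = (X1 - Y1) @\<^sub>r (X2 - Y2)"
  by (auto simp: append_rows_def append_cols_def intro!: eq_matI)

lemma append_cols_add:
  "dim_row X2 = dim_row X1 \<Longrightarrow> dim_row Y1 = dim_row X1 \<Longrightarrow> dim_row Y2 = dim_row X1 \<Longrightarrow>
    dim_col Y1 = dim_col X1 \<Longrightarrow> dim_col Y2 = dim_col X2 \<Longrightarrow>
    (X1 @\<^sub>c X2) + (Y1 @\<^sub>c Y2) = (X1 + Y1) @\<^sub>c (X2 + Y2)"
  by (auto simp: append_cols_def intro!: eq_matI)

lemma transpose_append_rows:
  fixes X1 X2 :: "real mat"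
  shows
  "dim_col X2 = dim_col X1 \<Longrightarrow>
    transpose_mat (X1 @\<^sub>r X2) = transpose_mat X1 @\<^sub>c transpose_mat X2"
  by (auto simp: append_rows_def append_cols_def intro!: eq_matI)


section \<open>The Moore--Penrose inverse of a matrix with two block columns\<close>

text \<open>Cline's formula. With \<open>S = [P Q]\<close> and \<open>X = p - T Y\<close>, the product \<open>S [X; Y]\<close> is
  \<open>P p + R r\<close>, a sum of two projectors with orthogonal ranges, because \<open>N\<close> is annihilated by
  \<open>R\<close>. This gives the two Penrose equations without transposes and one symmetry. The other
  symmetry concerns
  \<open>[X; Y] S = [p P - T Z G\<^sup>T, G Z; Z G\<^sup>T, r R + 1 - Z]\<close>; it holds because \<open>Z\<close> is symmetric
  and, being the inverse of \<open>1 + N T\<^sup>T T N\<close>, commutes with \<open>N\<close>.\<close>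

lemma is_mp_inverse_append_cols:
  fixes P Q p r R T N G Z Y :: "real mat"
  assumes P: "P \<in> carrier_mat M n" and Q: "Q \<in> carrier_mat M k"
    and p: "is_mp_inverse P p" and r: "is_mp_inverse R r"
    and T: "T = p * Q" and R: "R = Q - P * T"
    and N: "N = 1\<^sub>m k - r * R" and G: "G = T * N"
    and Z: "Z = mat_inv (1\<^sub>m k + transpose_mat G * G)"
    and Y: "Y = N * Z * transpose_mat T * (p - T * r) + r"
  shows "is_mp_inverse (P @\<^sub>c Q) ((p - T * Y) @\<^sub>r Y)"
proof -
  note pp = p[unfolded is_mp_inverse_def] and rr = r[unfolded is_mp_inverse_def]
  have dP [simp]: "dim_row P = M" "dim_col P = n" "dim_row Q = M" "dim_col Q = k"
    using P Q by auto
  have dp [simp]: "dim_row p = n" "dim_col p = M" using pp by auto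
  have dT [simp]: "dim_row T = n" "dim_col T = k" unfolding T by auto
  have dR [simp]: "dim_row R = M" "dim_col R = k" unfolding R by auto
  have dr [simp]: "dim_row r = k" "dim_col r = M" using rr by auto
  have dN [simp]: "dim_row N = k" "dim_col N = k" unfolding N by auto
  have dG [simp]: "dim_row G = n" "dim_col G = k" unfolding G by auto
  define W where "W = 1\<^sub>m k + transpose_mat G * G"
  have dW [simp]: "dim_row W = k" "dim_col W = k" unfolding W_def by auto
  have "W \<in> carrier_mat k k" "det W \<noteq> 0"
    using det_one_plus_gram[of G n k] dG unfolding W_def by (auto simp del: dG intro: carrier_matI)
  note inv = mat_inv_properties[OF this]
  have dZ [simp]: "dim_row Z = k" "dim_col Z = k" using inv(1) Z unfolding W_def by auto
  have WZ: "W * Z = 1\<^sub>m k" and ZW: "Z * W = 1\<^sub>m k" using inv unfolding Z W_def by auto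
  have dY [simp]: "dim_row Y = k" "dim_col Y = M" unfolding Y by auto

  have PpP: "P * (p * P) = P" and pPp: "p * (P * p) = p"
    using pp by (simp_all add: mat_ring_simps)
  have RrR: "R * (r * R) = R" and rRr: "r * (R * r) = r"
    using rr by (simp_all add: mat_ring_simps)
  have sPp: "transpose_mat (P * p) = P * p" and spP: "transpose_mat (p * P) = p * P"
    and sRr: "transpose_mat (R * r) = R * r" and srR: "transpose_mat (r * R) = r * R"
    using pp rr by auto

  \<comment> \<open>The columns of \<open>R\<close> are orthogonal to those of \<open>P\<close>.\<close>
  have pR: "p * R = 0\<^sub>m n k"
  proof -
    have "p * R = T - (p * (P * p)) * Q" unfolding R T by (simp add: mat_ring_simps)
    then show ?thesis unfolding pPp T by (simp add: mat_ring_simps)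
  qed
  have rP: "r * P = 0\<^sub>m k n"
  proof -
    have "transpose_mat (R * r * (P * p)) = transpose_mat (P * p) * transpose_mat (R * r)"
      by (rule transpose_dim) simp
    also have "\<dots> = P * (p * R) * r" unfolding sPp sRr by (simp add: mat_ring_simps)
    also have "\<dots> = 0\<^sub>m M M" unfolding pR by (simp add: mat_ring_simps)
    finally have "R * r * (P * p) = 0\<^sub>m M M"
      by (metis Matrix.transpose_transpose zero_transpose_mat)
    then have "r * (R * r * (P * p)) * P = 0\<^sub>m k n" by (simp add: mat_ring_simps)
    moreover have "r * (R * r * (P * p)) * P = (r * (R * r)) * (P * (p * P))"
      by (simp add: mat_ring_simps)
    ultimately show ?thesis unfolding rRr PpP by simp
  qed
  have rQ: "r * Q = r * R"
  proof -
    have "r * R = r * Q - (r * P) * T" unfolding R by (simp add: mat_ring_simps)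
    then show ?thesis unfolding rP by (simp add: mat_ring_simps)
  qed

  \<comment> \<open>\<open>N\<close> is the orthogonal projector onto the kernel of \<open>R\<close>; it commutes with \<open>Z\<close>.\<close>
  have RN: "R * N = 0\<^sub>m M k" unfolding N using RrR by (simp add: mat_ring_simps)
  have rRN: "(r * R) * N = 0\<^sub>m k k" using RN by (simp add: mat_ring_simps)
  have Nr: "N * r = 0\<^sub>m k M" unfolding N using rRr by (simp add: mat_ring_simps)
  have sN: "transpose_mat N = N" unfolding N using srR by (simp add: transpose_dim)
  have NN: "N * N = N"
  proof -
    have "N * N = N - (r * R) * N" by (subst (1) N) (simp add: mat_ring_simps)
    then show ?thesis unfolding rRN by (simp add: mat_ring_simps)
  qed
  have GT: "transpose_mat G = N * transpose_mat T" unfolding G using sN by (simp add: transpose_dim)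
  have NGT: "N * transpose_mat G = transpose_mat G" unfolding GT
    using NN by (simp add: mult_assoc_dim[symmetric])
  have GN: "G * N = G" unfolding G using NN by (simp add: mult_assoc_dim)
  have sW: "transpose_mat W = W" unfolding W_def by (simp add: mat_ring_simps)
  have sZ: "transpose_mat Z = Z"
  proof -
    have "transpose_mat Z = transpose_mat Z * (W * Z)" unfolding WZ by (simp add: mat_ring_simps)
    also have "\<dots> = transpose_mat (W * Z) * Z" using sW by (simp add: mat_ring_simps)
    finally show ?thesis unfolding WZ by (simp add: mat_ring_simps)
  qed
  have NW: "N * W = W * N"
  proof -
    have "N * W = N + (N * transpose_mat G) * G" unfolding W_def by (simp add: mat_ring_simps)
    also have "\<dots> = N + transpose_mat G * (G * N)" unfolding NGT GN ..
    also have "\<dots> = W * N" unfolding W_def by (simp add: mat_ring_simps)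
    finally show ?thesis .
  qed
  have NZ: "N * Z = Z * N"
  proof -
    have "N * Z = (Z * W) * (N * Z)" unfolding ZW by (simp add: mat_ring_simps)
    also have "\<dots> = Z * (W * N) * Z" by (simp add: mat_ring_simps)
    also have "\<dots> = Z * N * (W * Z)" unfolding NW[symmetric] by (simp add: mat_ring_simps)
    finally show ?thesis unfolding WZ by (simp add: mat_ring_simps)
  qed
  have rRZ: "(r * R) * Z = r * R"
  proof -
    have "(r * R) * W = r * R + ((r * R) * N) * transpose_mat T * G"
      unfolding W_def GT by (simp add: mat_ring_simps)
    then have a: "(r * R) * W = r * R" unfolding rRN by (simp add: mat_ring_simps)
    have "(r * R) * W * Z = (r * R) * (W * Z)" by (simp add: mult_assoc_dim)
    then show ?thesis unfolding a WZ by (simp add: unit_mult_dim)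
  qed
  have NZ_eq: "N * Z = Z - r * R"
  proof -
    have "N * Z = Z - (r * R) * Z" unfolding N by (simp add: mat_ring_simps)
    then show ?thesis unfolding rRZ .
  qed
  have ZGG: "Z * transpose_mat G * G = 1\<^sub>m k - Z"
  proof -
    have "1\<^sub>m k = Z + Z * transpose_mat G * G"
      using ZW unfolding W_def by (simp add: mat_ring_simps)
    then show ?thesis by (auto intro!: eq_matI)
  qed
  have NZT: "N * Z * transpose_mat T = Z * transpose_mat G"
    unfolding NZ GT by (simp add: mult_assoc_dim)

  \<comment> \<open>The product \<open>S [X; Y]\<close> is the projector onto the range of \<open>S\<close>.\<close>
  define X where "X = p - T * Y"
  have dX [simp]: "dim_row X = n" "dim_col X = M" unfolding X_def by auto
  have RY: "R * Y = R * r"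
  proof -
    have "R * Y = (R * N) * (Z * transpose_mat T * (p - T * r)) + R * r"
      unfolding Y by (simp add: mult_assoc_dim mult_distrib_dim(1))
    then show ?thesis unfolding RN by (simp add: mat_ring_simps)
  qed
  have PT: "P * T = Q - R" unfolding R by (auto intro!: eq_matI)
  have SX: "(P @\<^sub>c Q) * (X @\<^sub>r Y) = P * p + R * r"
  proof -
    have "(P @\<^sub>c Q) * (X @\<^sub>r Y) = P * X + Q * Y" by (rule append_cols_mult_append_rows) auto
    also have "P * X = P * p - (P * T) * Y" unfolding X_def by (simp add: mat_ring_simps)
    also have "\<dots> = P * p - (Q * Y - R * Y)" unfolding PT by (simp add: mat_ring_simps)
    finally show ?thesis unfolding RY
      by (auto intro!: eq_matI simp del: index_mult_mat(1))
  qed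
  have SXS: "(P * p + R * r) * (P @\<^sub>c Q) = P @\<^sub>c Q"
  proof -
    have "(P * p + R * r) * P = P"
      using PpP rP by (simp add: mat_ring_simps)
    moreover have "(P * p + R * r) * Q = P * T + R * (r * Q)"
      unfolding T by (simp add: mat_ring_simps)
    then have "(P * p + R * r) * Q = Q" unfolding rQ RrR PT
      by (auto intro!: eq_matI)
    ultimately show ?thesis by (simp add: mult_append_cols)
  qed
  have pS: "p * (P * p + R * r) = p"
  proof -
    have "p * (P * p + R * r) = p * (P * p) + (p * R) * r" by (simp add: mat_ring_simps)
    then show ?thesis unfolding pPp pR by (simp add: mat_ring_simps)
  qed
  have rS: "r * (P * p + R * r) = r"
  proof -
    have "r * (P * p + R * r) = (r * P) * p + r * (R * r)" by (simp add: mat_ring_simps)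
    then show ?thesis unfolding rRr rP by (simp add: mat_ring_simps)
  qed
  have YS: "Y * (P * p + R * r) = Y"
  proof -
    have "Y * (P * p + R * r) = N * Z * transpose_mat T *
        (p * (P * p + R * r) - T * (r * (P * p + R * r))) + r * (P * p + R * r)"
      unfolding Y by (simp add: mult_assoc_dim mult_distrib_dim(2-4))
    then show ?thesis unfolding pS rS Y .
  qed
  have XSX: "(X @\<^sub>r Y) * (P * p + R * r) = X @\<^sub>r Y"
  proof -
    have "X * (P * p + R * r) = p * (P * p + R * r) - T * (Y * (P * p + R * r))"
      unfolding X_def by (simp add: mult_assoc_dim mult_distrib_dim(2-4))
    then have "X * (P * p + R * r) = X" unfolding pS YS X_def .
    then show ?thesis using YS by (simp add: append_rows_mult)
  qed

  \<comment> \<open>The blocks of \<open>[X; Y] S\<close>.\<close>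
  have TpP: "transpose_mat T * (p * P) = transpose_mat T"
  proof -
    have "transpose_mat (p * P * T) = transpose_mat T * transpose_mat (p * P)"
      by (rule transpose_dim) simp
    moreover have "p * P * T = T" unfolding T using pPp by (simp add: mult_assoc_dim[symmetric])
    ultimately show ?thesis unfolding spP by simp
  qed
  have YP: "Y * P = Z * transpose_mat G"
  proof -
    have "Y * P = N * Z * (transpose_mat T * (p * P)) - N * Z * transpose_mat T * T * (r * P) + r * P"
      unfolding Y by (simp add: mat_ring_simps)
    then show ?thesis unfolding TpP rP NZT by (simp add: mat_ring_simps)
  qed
  have YQ: "Y * Q = r * R + (1\<^sub>m k - Z)"
  proof -
    have "Y * Q = N * Z * transpose_mat T * (p * Q - T * (r * Q)) + r * Q"
      unfolding Y by (simp add: mult_assoc_dim mult_distrib_dim)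
    also have "p * Q - T * (r * Q) = G"
      unfolding rQ G N T by (simp add: mat_ring_simps)
    finally show ?thesis unfolding NZT ZGG rQ by (auto intro!: eq_matI simp del: index_mult_mat(1))
  qed
  have XP: "X * P = p * P - T * Z * transpose_mat G"
    unfolding X_def using YP by (simp add: mat_ring_simps)
  have XQ: "X * Q = G * Z"
  proof -
    have "X * Q = T * (1\<^sub>m k - Y * Q)" unfolding X_def using T by (simp add: mat_ring_simps)
    also have "1\<^sub>m k - Y * Q = N * Z" unfolding YQ NZ_eq
      by (auto intro!: eq_matI simp del: index_mult_mat(1))
    finally show ?thesis unfolding G by (simp add: mult_assoc_dim)
  qed
  have sXP: "transpose_mat (X * P) = X * P"
  proof -
    have "transpose_mat (T * Z * transpose_mat G) = G * Z * transpose_mat T"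
      using sZ by (simp add: transpose_dim mult_assoc_dim)
    also have "\<dots> = T * (N * Z) * transpose_mat T" unfolding G by (simp add: mult_assoc_dim)
    also have "\<dots> = T * Z * transpose_mat G" unfolding NZ GT by (simp add: mult_assoc_dim)
    finally have "transpose_mat (T * Z * transpose_mat G) = T * Z * transpose_mat G" .
    then show ?thesis unfolding XP using spP by (simp add: transpose_dim(3))
  qed
  have sYQ: "transpose_mat (Y * Q) = Y * Q"
    unfolding YQ using srR sZ by (simp add: transpose_dim(2,3))
  have sYP: "transpose_mat (Y * P) = X * Q" and sXQ: "transpose_mat (X * Q) = Y * P"
    unfolding YP XQ using sZ by (simp_all add: transpose_dim)
  have XS: "(X @\<^sub>r Y) * (P @\<^sub>c Q) = four_block_mat (X * P) (X * Q) (Y * P) (Y * Q)"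
    by (rule append_rows_mult_append_cols) auto
  have "transpose_mat ((X @\<^sub>r Y) * (P @\<^sub>c Q)) = (X @\<^sub>r Y) * (P @\<^sub>c Q)"
    unfolding XS
    by (subst transpose_four_block_mat[of _ n n _ k _ k])
      (simp_all add: sXP sYQ sYP sXQ carrier_matI)
  moreover have "transpose_mat (P * p + R * r) = P * p + R * r"
    using sPp sRr by (simp add: transpose_dim(2))
  moreover have "(X @\<^sub>r Y) * (P @\<^sub>c Q) * (X @\<^sub>r Y) = X @\<^sub>r Y"
    using XSX SX by (simp add: mult_assoc_dim)
  ultimately show ?thesis
    unfolding is_mp_inverse_def X_def[symmetric] SX using SXS by (auto intro!: carrier_matI)
qed

section \<open>The Moore--Penrose inverse of the block-structure matrix\<close>

theorem theorem3p10:
  fixes A S1 S2 S L11 L21 L22 U11 U12 U22 B C D E F G H K :: "real mat"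
    and m n :: nat
  assumes "A \<in> carrier_mat m n"
    and "S1 = pos_part_mat A"
    and "S2 = neg_part_mat A"
    and "S = block_structure_mat A"
    and "mat_range S2 \<subseteq> mat_range S1"
    and "block_crrmcf_decomposition S1 S2 L11 L21 L22 U11 U12 U22"
    and "S = four_block_mat L11 (0\<^sub>m m n) L21 L22 * four_block_mat U11 U12 (0\<^sub>m n n) U22"
    and "B = transpose_mat (L11 * U11) * (L11 * U11) + transpose_mat (L21 * U11) * (L21 * U11)"
    and "C = transpose_mat (L11 * U11) * (L11 * U12)
           + transpose_mat (L21 * U11) * (L21 * U12 + L22 * U22)"
    and "D = L11 * U12 - L11 * U11 * mp_inverse B * C"
    and "E = (L21 * U12 + L22 * U22) - L21 * U11 * mp_inverse B * C"
    and "F = transpose_mat D * D + transpose_mat E * E"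
    and "G = mp_inverse B * C * (1\<^sub>m n - mp_inverse F * F)"
    and "H = (1\<^sub>m n - mp_inverse F * F) * mat_inv (1\<^sub>m n + transpose_mat G * G)
             * transpose_mat (mp_inverse B * C) * mp_inverse B
             * (transpose_mat (L11 * U11) - C * mp_inverse F * transpose_mat D)"
    and "K = (1\<^sub>m n - mp_inverse F * F) * mat_inv (1\<^sub>m n + transpose_mat G * G)
             * transpose_mat (mp_inverse B * C) * mp_inverse B
             * (transpose_mat (L21 * U11) - C * mp_inverse F * transpose_mat E)"
  shows "mp_inverse S =
    four_block_mat
      (mp_inverse B * (transpose_mat (L11 * U11) - C * (H + mp_inverse F * transpose_mat D)))
      (mp_inverse B * (transpose_mat (L21 * U11) - C * (K + mp_inverse F * transpose_mat E)))
      (H + mp_inverse F * transpose_mat D)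
      (K + mp_inverse F * transpose_mat E)"
proof -
  have A: "A \<in> carrier_mat m n" by (rule assms(1))
  have S1 [simp]: "dim_row S1 = m" "dim_col S1 = n" and S2 [simp]: "dim_row S2 = m" "dim_col S2 = n"
    using A unfolding assms(2,3) pos_part_mat_def neg_part_mat_def by auto
  note dec = assms(6)[unfolded block_crrmcf_decomposition_def crrmcf_decomposition_def]
  have L11 [simp]: "dim_row L11 = m" "dim_col L11 = n"
    and U11 [simp]: "dim_row U11 = n" "dim_col U11 = n" using dec by auto
  \<comment> \<open>The shape of \<open>L21\<close> depends on \<open>U11\<close> being invertible: \<open>mat_inv\<close> of a singular
    matrix is unspecified.\<close>
  have iU11 [simp]: "dim_row (mat_inv U11) = n" "dim_col (mat_inv U11) = n"
  proof -
    have U: "U11 \<in> carrier_mat n n" by (rule carrier_matI) auto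
    moreover have "det U11 \<noteq> 0"
      using det_upper_triangular[OF _ U] dec
      unfolding unit_upper_triangular_def diag_mat_def by (auto simp: prod_list_zero_iff)
    ultimately show "dim_row (mat_inv U11) = n" "dim_col (mat_inv U11) = n"
      using mat_inv_properties(1) by auto
  qed
  have L21 [simp]: "dim_row L21 = m" "dim_col L21 = n" using dec by auto
  have "dim_row (mp_inverse L11) = n"
    using is_mp_inverse_mp_inverse[of L11] unfolding is_mp_inverse_def by auto
  then have U12 [simp]: "dim_row U12 = n" "dim_col U12 = n" using dec by auto
  have L22 [simp]: "dim_row L22 = m" "dim_col L22 = n"
    and U22 [simp]: "dim_row U22 = n" "dim_col U22 = n" using dec by auto

  define P1 P2 Q1 Q2 where "P1 = L11 * U11" and "P2 = L21 * U11"
    and "Q1 = L11 * U12" and "Q2 = L21 * U12 + L22 * U22"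
  have dims [simp]: "dim_row P1 = m" "dim_col P1 = n" "dim_row P2 = m" "dim_col P2 = n"
    "dim_row Q1 = m" "dim_col Q1 = n" "dim_row Q2 = m" "dim_col Q2 = n"
    unfolding P1_def P2_def Q1_def Q2_def by auto
  note fold = P1_def[symmetric] P2_def[symmetric] Q1_def[symmetric] Q2_def[symmetric]
  note defs = assms(8-15)[unfolded fold]
  define P Q where "P = P1 @\<^sub>r P2" and "Q = Q1 @\<^sub>r Q2"
  have dPQ [simp]: "dim_row P = m + m" "dim_col P = n" "dim_row Q = m + m" "dim_col Q = n"
    unfolding P_def Q_def by auto
  have S: "S = P @\<^sub>c Q"
  proof -
    have "S = four_block_mat P1 Q1 P2 Q2"
      unfolding assms(7) fold[symmetric]
      by (subst mult_four_block_mat[of _ m n _ n _ m _ _ n _ n])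
        (auto intro!: carrier_matI simp: mat_ring_simps)
    then show ?thesis unfolding P_def Q_def by (simp add: four_block_append(2))
  qed

  have PtP: "transpose_mat P * P = B" and PtQ: "transpose_mat P * Q = C"
    unfolding P_def Q_def defs(1,2)
    by (simp_all add: transpose_append_rows append_cols_mult_append_rows)
  define p where "p = mp_inverse B * transpose_mat P"
  have p: "is_mp_inverse P p" using is_mp_inverse_gram[of P] unfolding p_def PtP .
  have "dim_row B = n" "dim_col B = n" unfolding defs(1) by auto
  then have dB [simp]: "dim_row (mp_inverse B) = n" "dim_col (mp_inverse B) = n"
    using is_mp_inverse_mp_inverse[of B] unfolding is_mp_inverse_def by auto
  have dC [simp]: "dim_row C = n" "dim_col C = n" unfolding defs(2) by auto
  define T where "T = mp_inverse B * C"
  have dT [simp]: "dim_row T = n" "dim_col T = n" unfolding T_def by auto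
  have T: "T = p * Q" unfolding T_def p_def PtQ[symmetric] by (simp add: mat_ring_simps)
  have D: "D = Q1 - P1 * T" and E: "E = Q2 - P2 * T"
    unfolding defs(3,4) T_def by (simp_all add: mat_ring_simps)
  have dDE [simp]: "dim_row D = m" "dim_col D = n" "dim_row E = m" "dim_col E = n"
    unfolding D E by auto
  define R where "R = D @\<^sub>r E"
  have dR [simp]: "dim_row R = m + m" "dim_col R = n" unfolding R_def by auto
  have R: "R = Q - P * T"
    unfolding R_def P_def Q_def D E by (simp add: append_rows_mult append_minus)
  have RtR: "transpose_mat R * R = F"
    unfolding R_def defs(5) by (simp add: transpose_append_rows append_cols_mult_append_rows)
  define r where "r = mp_inverse F * transpose_mat R"
  have r: "is_mp_inverse R r" using is_mp_inverse_gram[of R] unfolding r_def RtR .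
  have dF' [simp]: "dim_row F = n" "dim_col F = n" unfolding defs(5) by auto
  then have dF [simp]: "dim_row (mp_inverse F) = n" "dim_col (mp_inverse F) = n"
    using is_mp_inverse_mp_inverse[of F] unfolding is_mp_inverse_def by auto
  define N where "N = 1\<^sub>m n - mp_inverse F * F"
  have N: "N = 1\<^sub>m n - r * R"
  proof -
    have "r * R = mp_inverse F * (transpose_mat R * R)" unfolding r_def by (rule mult_assoc_dim) auto
    then show ?thesis unfolding N_def RtR by simp
  qed
  have dN [simp]: "dim_row N = n" "dim_col N = n" unfolding N_def by auto
  have G: "G = T * N" unfolding defs(6) T_def N_def ..
  have dG [simp]: "dim_row G = n" "dim_col G = n" unfolding G by auto
  define Z where "Z = mat_inv (1\<^sub>m n + transpose_mat G * G)"
  have "G \<in> carrier_mat n n" by (rule carrier_matI) auto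
  then have "1\<^sub>m n + transpose_mat G * G \<in> carrier_mat n n"
    "det (1\<^sub>m n + transpose_mat G * G) \<noteq> 0" using det_one_plus_gram by auto
  then have "Z \<in> carrier_mat n n" unfolding Z_def by (rule mat_inv_properties)
  then have dZ [simp]: "dim_row Z = n" "dim_col Z = n" by auto

  define Y where "Y = N * Z * transpose_mat T * (p - T * r) + r"
  have p_blocks: "p = (mp_inverse B * transpose_mat P1) @\<^sub>c (mp_inverse B * transpose_mat P2)"
    unfolding p_def P_def by (simp add: transpose_append_rows mult_append_cols)
  have r_blocks: "r = (mp_inverse F * transpose_mat D) @\<^sub>c (mp_inverse F * transpose_mat E)"
    unfolding r_def R_def by (simp add: transpose_append_rows mult_append_cols)
  have H: "H = N * Z * transpose_mat T * (mp_inverse B * transpose_mat P1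
      - T * (mp_inverse F * transpose_mat D))"
    unfolding defs(7) N_def[symmetric] Z_def[symmetric] T_def by (simp add: mat_ring_simps)
  have K: "K = N * Z * transpose_mat T * (mp_inverse B * transpose_mat P2
      - T * (mp_inverse F * transpose_mat E))"
    unfolding defs(8) N_def[symmetric] Z_def[symmetric] T_def by (simp add: mat_ring_simps)
  have dHK [simp]: "dim_row H = n" "dim_col H = m" "dim_row K = n" "dim_col K = m"
    unfolding H K by auto
  have Y: "Y = (H + mp_inverse F * transpose_mat D) @\<^sub>c (K + mp_inverse F * transpose_mat E)"
    unfolding Y_def p_blocks r_blocks H K
    by (simp add: mult_append_cols append_minus append_cols_add)
  have X: "p - T * Y
    = (mp_inverse B * (transpose_mat P1 - C * (H + mp_inverse F * transpose_mat D)))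
      @\<^sub>c (mp_inverse B * (transpose_mat P2 - C * (K + mp_inverse F * transpose_mat E)))"
    unfolding p_blocks Y
    by (simp add: mult_append_cols append_minus T_def mult_assoc_dim mult_distrib_dim(2))
  have "is_mp_inverse S ((p - T * Y) @\<^sub>r Y)"
    unfolding S
    by (rule is_mp_inverse_append_cols[OF _ _ p r T R N G Z_def Y_def, where M = "m + m"])
      (auto intro: carrier_matI)
  then have "mp_inverse S = (p - T * Y) @\<^sub>r Y" by (rule mp_inverse_eqI)
  then show ?thesis
    unfolding X unfolding Y fold by (simp add: four_block_append(1))
qed

end
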